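(* Let $n\geq 2$ and let $\mathbb{K}$ be a field of characteristic different from $2$. An extension (surjective homomorphism) of Leibniz $n$-algebras $f\colon\mathscr{B}\to\mathscr{A}$ over $\mathbb{K}$ with kernel $\mathscr{K}$ is central with respect to the subvariety of Lie $n$-algebras if and only if the ideal $\langle\mathscr{K},\mathscr{B},\dots,\mathscr{B}\rangle$ of $\mathscr{B}$ is zero.
   Context: A Leibniz $n$-algebra over $\mathbb{K}$ is a $\mathbb{K}$-vector space $\mathscr{L}$ with an $n$-linear operation $[-,\dots,-]\colon\mathscr{L}^n\to\mathscr{L}$ satisfying $$[[l_{1},\dots,l_{n}],l'_{1},\dots,l'_{n-1}]=\sum_{1\leq i\leq n}[l_{1},\dots,l_{i-1},[l_{i},l'_{1},\dots,l'_{n-1}],l_{i+1},\dots,l_{n}].$$ It is a Lie $n$-algebra if moreover $[l_1,\dots,l_n]=\mathrm{sgn}(\sigma)[l_{\sigma(1)},\dots,l_{\sigma(n)}]$ for all $\sigma\in S_n$. Homomorphisms are linear maps preserving the bracket. Ideals are subspaces $\mathscr{N}$ such that $[l_1,\dots,l_n]\in\mathscr{N}$ whenever some $l_i\in\mathscr{N}$. For $\sigma\in S_n$ put $\langle l_1,\dots,l_n\rangle_\sigma=[l_1,\dots,l_n]-\mathrm{sgn}(\sigma)[l_{\sigma(1)},\dots,l_{\sigma(n)}]$. For ideals $\mathscr{N}_1,\dots,\mathscr{N}_n$ of $\mathscr{L}$, the relative commutator $\langle\mathscr{N}_1,\dots,\mathscr{N}_n\rangle$ is the ideal of $\mathscr{L}$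 generated by all $\langle l_1,\dots,l_n\rangle_\sigma$ with $l_1\in\mathscr{N}_1,\dots,l_n\in\mathscr{N}_n$ and $\sigma\in S_n$. The left adjoint of the inclusion of Lie $n$-algebras into Leibniz $n$-algebras is $\mathscr{L}\mapsto\mathscr{L}/\langle\mathscr{L},\dots,\mathscr{L}\rangle$. Let $R[f]=\{(x,y)\in\mathscr{B}\times\mathscr{B}: f(x)=f(y)\}$ with projections $f_0,f_1\colon R[f]\to\mathscr{B}$. The extension $f$ is central with respect to Lie $n$-algebras when the restrictions of $f_0$ and $f_1$ to maps $\langle R[f],\dots,R[f]\rangle\to\langle\mathscr{B},\dots,\mathscr{B}\rangle$ coincide. *)

theory Defs
  imports Complex_Main
    "HOL-Library.NList"
    "HOL-Library.Product_Plus"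
    "HOL-Combinatorics.Permutations"
begin

text \<open>
  An \<open>n\<close>-ary bracket is a function on lists, of which only the values on lists of length \<open>n\<close>
  over the carrier matter; positions are counted from \<open>0\<close>. The carrier \<open>L\<close> is a linear subspace
  of the ambient type, so that the kernel pair \<open>R[f]\<close>, a proper subset of \<open>B \<times> B\<close>, is again an
  algebra in the same sense.
\<close>

locale leibniz_n_algebra = vector_space scale
  for scale :: "'k::field \<Rightarrow> 'v::ab_group_add \<Rightarrow> 'v" +
  fixes n :: nat and L :: "'v set" and br :: "'v list \<Rightarrow> 'v"
  assumes subspace_carrier: "subspace L"
    and closed: "xs \<in> nlists n L \<Longrightarrow> br xs \<in> L"
    and add: "xs \<in> nlists n L \<Longrightarrow> i < n \<Longrightarrow> x \<in> L \<Longrightarrow> y \<in> L \<Longrightarrow>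
      br (xs[i := x + y]) = br (xs[i := x]) + br (xs[i := y])"
    and scale: "xs \<in> nlists n L \<Longrightarrow> i < n \<Longrightarrow> x \<in> L \<Longrightarrow>
      br (xs[i := scale c x]) = scale c (br (xs[i := x]))"
    and leibniz: "xs \<in> nlists n L \<Longrightarrow> ys \<in> nlists (n - 1) L \<Longrightarrow>
      br (br xs # ys) = (\<Sum>i<n. br (xs[i := br (xs ! i # ys)]))"

definition n_algebra_hom ::
  "('k::field \<Rightarrow> 'b::ab_group_add \<Rightarrow> 'b) \<Rightarrow> ('k \<Rightarrow> 'a::ab_group_add \<Rightarrow> 'a) \<Rightarrow> nat \<Rightarrow>
    'b set \<Rightarrow> ('b list \<Rightarrow> 'b) \<Rightarrow> 'a set \<Rightarrow> ('a list \<Rightarrow> 'a) \<Rightarrow> ('b \<Rightarrow> 'a) \<Rightarrow> bool" where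
  "n_algebra_hom sB sA n B brB A brA f \<longleftrightarrow>
    f ` B \<subseteq> A \<and>
    (\<forall>x\<in>B. \<forall>y\<in>B. f (x + y) = f x + f y) \<and>
    (\<forall>c. \<forall>x\<in>B. f (sB c x) = sA c (f x)) \<and>
    (\<forall>xs\<in>nlists n B. f (brB xs) = brA (map f xs))"

definition extension ::
  "('k::field \<Rightarrow> 'b::ab_group_add \<Rightarrow> 'b) \<Rightarrow> ('k \<Rightarrow> 'a::ab_group_add \<Rightarrow> 'a) \<Rightarrow> nat \<Rightarrow>
    'b set \<Rightarrow> ('b list \<Rightarrow> 'b) \<Rightarrow> 'a set \<Rightarrow> ('a list \<Rightarrow> 'a) \<Rightarrow> ('b \<Rightarrow> 'a) \<Rightarrow> bool" where
  "extension sB sA n B brB A brA f \<longleftrightarrow> n_algebra_hom sB sA n B brB A brA f \<and> f ` B = A"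

definition hom_kernel :: "'b set \<Rightarrow> ('b \<Rightarrow> 'a::zero) \<Rightarrow> 'b set" where
  "hom_kernel B f = {x \<in> B. f x = 0}"

definition n_ideal ::
  "('k::field \<Rightarrow> 'v::ab_group_add \<Rightarrow> 'v) \<Rightarrow> nat \<Rightarrow> 'v set \<Rightarrow> ('v list \<Rightarrow> 'v) \<Rightarrow> 'v set \<Rightarrow> bool" where
  "n_ideal s n L br N \<longleftrightarrow>
    module.subspace s N \<and> N \<subseteq> L \<and> (\<forall>xs\<in>nlists n L. (\<exists>i<n. xs ! i \<in> N) \<longrightarrow> br xs \<in> N)"

definition angle_bracket ::
  "('k::field \<Rightarrow> 'v::ab_group_add \<Rightarrow> 'v) \<Rightarrow> ('v list \<Rightarrow> 'v) \<Rightarrow> (nat \<Rightarrow> nat) \<Rightarrow> 'v list \<Rightarrow> 'v" where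
  "angle_bracket s br \<sigma> xs = br xs - s (of_int (sign \<sigma>)) (br (permute_list \<sigma> xs))"

text \<open>The relative commutator of the list of ideals \<open>Ns\<close>, which should have length \<open>n\<close>.\<close>

definition relative_commutator ::
  "('k::field \<Rightarrow> 'v::ab_group_add \<Rightarrow> 'v) \<Rightarrow> nat \<Rightarrow> 'v set \<Rightarrow> ('v list \<Rightarrow> 'v) \<Rightarrow> 'v set list \<Rightarrow> 'v set" where
  "relative_commutator s n L br Ns =
    n_ideal s n L br hull {angle_bracket s br \<sigma> xs | \<sigma> xs. \<sigma> permutes {..<n} \<and> xs \<in> listset Ns}"

definition kernel_pair :: "'b set \<Rightarrow> ('b \<Rightarrow> 'a) \<Rightarrow> ('b \<times> 'b) set" where
  "kernel_pair B f = {(x, y). x \<in> B \<and> y \<in> B \<and> f x = f y}"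

definition prod_scale :: "('k \<Rightarrow> 'v \<Rightarrow> 'v) \<Rightarrow> 'k \<Rightarrow> 'v \<times> 'v \<Rightarrow> 'v \<times> 'v" where
  "prod_scale s c = map_prod (s c) (s c)"

definition prod_bracket :: "('v list \<Rightarrow> 'v) \<Rightarrow> ('v \<times> 'v) list \<Rightarrow> 'v \<times> 'v" where
  "prod_bracket br ps = (br (map fst ps), br (map snd ps))"

definition central_extension ::
  "('k::field \<Rightarrow> 'b::ab_group_add \<Rightarrow> 'b) \<Rightarrow> nat \<Rightarrow> 'b set \<Rightarrow> ('b list \<Rightarrow> 'b) \<Rightarrow> ('b \<Rightarrow> 'a) \<Rightarrow> bool" where
  "central_extension s n B br f \<longleftrightarrow>
    (let R = kernel_pair B f
     in \<forall>p \<in> relative_commutator (prod_scale s) n R (prod_bracket br) (replicate n R). fst p = snd p)"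

text \<open>
  The kernel pair is a Leibniz \<open>n\<close>-algebra, and the projections do restrict to maps
  \<open>\<langle>R[f], \<dots>, R[f]\<rangle> \<rightarrow> \<langle>B, \<dots>, B\<rangle>\<close>, as the definition of centrality presupposes.
\<close>

lemma vector_space_prod_scale:
  assumes "vector_space s" shows "vector_space (prod_scale s)"
proof -
  interpret vector_space s by fact
  show ?thesis
    by unfold_locales
      (auto simp: prod_scale_def scale_right_distrib scale_left_distrib)
qed

lemma listset_replicate: "listset (replicate n A) = nlists n A"
  by (induction n) (auto simp only: replicate.simps listset.simps set_Cons_def nlists_n_0 nlists_Suc)

lemma kernel_pair_leibniz:
  assumes "leibniz_n_algebra sB n B brB"
    and "leibniz_n_algebra sA n A brA"
    and hom: "n_algebra_hom sB sA n B brB A brA f"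
    and n: "n \<ge> 1"
  shows "leibniz_n_algebra (prod_scale sB) n (kernel_pair B f) (prod_bracket brB)"
proof -
  interpret B: leibniz_n_algebra sB n B brB by fact
  interpret A: leibniz_n_algebra sA n A brA by fact
  interpret P: vector_space "prod_scale sB"
    by (rule vector_space_prod_scale) (rule B.vector_space_axioms)
  let ?R = "kernel_pair B f"
  have f0: "f 0 = 0"
  proof -
    have "f (0 + 0) = f 0 + f 0"
      using B.subspace_0[OF B.subspace_carrier] hom by (simp only: n_algebra_hom_def)
    then show ?thesis by simp
  qed
  have R1: "map fst ps \<in> nlists m B" and R2: "map snd ps \<in> nlists m B"
    and R3: "map f (map fst ps) = map f (map snd ps)" if "ps \<in> nlists m ?R" for ps m
  proof -
    have len: "length ps = m" and sub: "set ps \<subseteq> ?R"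
      using nlistsE_length[OF that] nlistsE_set[OF that] by blast+
    have mem: "fst p \<in> B \<and> snd p \<in> B \<and> f (fst p) = f (snd p)" if "p \<in> set ps" for p
      using subsetD[OF sub that] by (cases p) (simp add: kernel_pair_def)
    show "map fst ps \<in> nlists m B" and "map snd ps \<in> nlists m B"
      by (rule nlistsI; use len mem in \<open>force\<close>)+
    show "map f (map fst ps) = map f (map snd ps)"
      unfolding map_map comp_def by (rule map_cong[OF refl]) (use mem in blast)
  qed
  have Rb: "prod_bracket brB ps \<in> ?R" if "ps \<in> nlists n ?R" for ps
  proof -
    have "f (brB (map fst ps)) = brA (map f (map fst ps))"
      and "f (brB (map snd ps)) = brA (map f (map snd ps))"
      using hom R1[OF that] R2[OF that] by (simp_all only: n_algebra_hom_def)
    then have "f (brB (map fst ps)) = f (brB (map snd ps))"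
      using R3[OF that] by (simp only:)
    then show ?thesis
      using B.closed[OF R1[OF that]] B.closed[OF R2[OF that]]
      by (simp add: kernel_pair_def prod_bracket_def)
  qed
  show ?thesis
  proof
    show "P.subspace ?R"
      using B.subspace_carrier hom
      by (auto simp: P.subspace_def B.subspace_def kernel_pair_def prod_scale_def
          zero_prod_def n_algebra_hom_def f0)
    show "prod_bracket brB ps \<in> ?R" if "ps \<in> nlists n ?R" for ps
      using Rb that .
    show "prod_bracket brB (ps[i := x + y]) = prod_bracket brB (ps[i := x]) + prod_bracket brB (ps[i := y])"
      if "ps \<in> nlists n ?R" "i < n" "x \<in> ?R" "y \<in> ?R" for ps i x y
      using that R1[OF that(1)] R2[OF that(1)]
      by (auto simp: prod_bracket_def map_update kernel_pair_def B.add)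
    show "prod_bracket brB (ps[i := prod_scale sB c x]) = prod_scale sB c (prod_bracket brB (ps[i := x]))"
      if "ps \<in> nlists n ?R" "i < n" "x \<in> ?R" for ps i c x
      using that R1[OF that(1)] R2[OF that(1)]
      by (auto simp: prod_bracket_def map_update kernel_pair_def prod_scale_def B.scale)
    show "prod_bracket brB (prod_bracket brB xs # ys) =
        (\<Sum>i<n. prod_bracket brB (xs[i := prod_bracket brB (xs ! i # ys)]))"
      if xs: "xs \<in> nlists n ?R" and ys: "ys \<in> nlists (n - 1) ?R" for xs ys
    proof -
      have l: "length xs = n" using nlistsE_length[OF xs] .
      have "(\<Sum>i<n. brB (map fst (xs[i := prod_bracket brB (xs ! i # ys)]))) =
          (\<Sum>i<n. brB ((map fst xs)[i := brB (map fst xs ! i # map fst ys)]))"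
        by (rule sum.cong[OF refl]) (simp add: prod_bracket_def map_update l)
      moreover have "(\<Sum>i<n. brB (map snd (xs[i := prod_bracket brB (xs ! i # ys)]))) =
          (\<Sum>i<n. brB ((map snd xs)[i := brB (map snd xs ! i # map snd ys)]))"
        by (rule sum.cong[OF refl]) (simp add: prod_bracket_def map_update l)
      ultimately show ?thesis
        using B.leibniz[OF R1[OF xs] R1[OF ys]] B.leibniz[OF R2[OF xs] R2[OF ys]]
        by (intro prod_eqI) (simp_all only: prod_bracket_def fst_sum snd_sum fst_conv snd_conv list.map)
    qed
  qed
qed

lemma n_ideal_relative_commutator:
  assumes "leibniz_n_algebra s n L br" and n: "n \<ge> 1"
  shows "n_ideal s n L br (relative_commutator s n L br (replicate n L))"
proof -
  interpret leibniz_n_algebra s n L br by fact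
  let ?X = "{angle_bracket s br \<sigma> xs | \<sigma> xs. \<sigma> permutes {..<n} \<and> xs \<in> listset (replicate n L)}"
  have "angle_bracket s br \<sigma> xs \<in> L" if \<sigma>: "\<sigma> permutes {..<n}" and xs: "xs \<in> nlists n L" for \<sigma> xs
  proof -
    have "permute_list \<sigma> xs \<in> nlists n L"
      using \<sigma> nlistsE_length[OF xs] nlistsE_set[OF xs] by (intro nlistsI) simp_all
    then show ?thesis
      unfolding angle_bracket_def
      by (intro subspace_diff subspace_scale subspace_carrier closed xs)
  qed
  then have X: "?X \<subseteq> L" by (auto simp: listset_replicate)
  have L: "n_ideal s n L br L"
    using subspace_carrier closed by (auto simp: n_ideal_def)
  have sub: "n_ideal s n L br hull ?X \<subseteq> L"
    using hull_minimal[OF X, of "n_ideal s n L br"] L .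
  have "subspace (n_ideal s n L br hull ?X)"
    unfolding hull_def by (rule subspace_Inter) (auto simp: n_ideal_def)
  moreover have "\<forall>xs\<in>nlists n L. (\<exists>i<n. xs ! i \<in> n_ideal s n L br hull ?X) \<longrightarrow>
      br xs \<in> n_ideal s n L br hull ?X"
    unfolding hull_def n_ideal_def by blast
  ultimately have "n_ideal s n L br (n_ideal s n L br hull ?X)"
    using sub by (simp only: n_ideal_def[of s n L br "n_ideal s n L br hull ?X"] simp_thms)
  then show ?thesis unfolding relative_commutator_def .
qed

lemma kernel_pair_projections:
  assumes B: "leibniz_n_algebra sB n B brB"
    and A: "leibniz_n_algebra sA n A brA"
    and hom: "n_algebra_hom sB sA n B brB A brA f"
    and n: "n \<ge> 1"
    and \<pi>: "\<pi> = fst \<or> \<pi> = snd"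
  defines "R \<equiv> kernel_pair B f"
  shows "\<pi> ` relative_commutator (prod_scale sB) n R (prod_bracket brB) (replicate n R)
    \<subseteq> relative_commutator sB n B brB (replicate n B)" (is "_ ` ?CR \<subseteq> ?C")
proof -
  interpret B: leibniz_n_algebra sB n B brB by fact
  interpret R: leibniz_n_algebra "prod_scale sB" n R "prod_bracket brB"
    unfolding R_def using kernel_pair_leibniz[OF B A hom n] .
  let ?D = "{p \<in> R. \<pi> p \<in> ?C}"
  have C: "n_ideal sB n B brB ?C" by (rule n_ideal_relative_commutator[OF B n])
  have add: "\<pi> (p + q) = \<pi> p + \<pi> q" and minus: "\<pi> (p - q) = \<pi> p - \<pi> q"
    and sc: "\<pi> (prod_scale sB c p) = sB c (\<pi> p)" and zero: "\<pi> 0 = 0"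
    and brk: "\<pi> (prod_bracket brB ps) = brB (map \<pi> ps)" for p q c ps
    using \<pi> by (auto simp: prod_scale_def prod_bracket_def zero_prod_def)
  have \<pi>R: "map \<pi> ps \<in> nlists n B" if "ps \<in> nlists n R" for ps
  proof (rule nlistsI)
    show "length (map \<pi> ps) = n" using nlistsE_length[OF that] by simp
    show "set (map \<pi> ps) \<subseteq> B"
      using nlistsE_set[OF that] \<pi> by (auto simp: R_def kernel_pair_def)
  qed
  have "R.subspace ?D"
    using R.subspace_carrier C
    by (auto simp: R.subspace_def B.subspace_def n_ideal_def add sc zero)
  moreover have "prod_bracket brB ps \<in> ?D" if "ps \<in> nlists n R" "i < n" "ps ! i \<in> ?D" for ps i
  proof -
    have "map \<pi> ps ! i \<in> ?C" using that nlistsE_length[OF that(1)] by simp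
    then have "brB (map \<pi> ps) \<in> ?C"
      using C \<pi>R[OF that(1)] \<open>i < n\<close> unfolding n_ideal_def by blast
    then show ?thesis using R.closed[OF that(1)] by (simp add: brk)
  qed
  ultimately have D: "n_ideal (prod_scale sB) n R (prod_bracket brB) ?D"
    unfolding n_ideal_def by blast
  have "angle_bracket (prod_scale sB) (prod_bracket brB) \<sigma> ps \<in> ?D"
    if \<sigma>: "\<sigma> permutes {..<n}" and ps: "ps \<in> nlists n R" for \<sigma> ps
  proof -
    have perm: "permute_list \<sigma> ps \<in> nlists n R"
      using \<sigma> nlistsE_length[OF ps] nlistsE_set[OF ps] by (intro nlistsI) simp_all
    have "\<pi> (angle_bracket (prod_scale sB) (prod_bracket brB) \<sigma> ps) = angle_bracket sB brB \<sigma> (map \<pi> ps)"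
      using \<sigma> nlistsE_length[OF ps] by (simp add: angle_bracket_def minus sc brk permute_list_map)
    also have "\<dots> \<in> ?C"
      unfolding relative_commutator_def
      by (rule hull_inc) (use \<sigma> \<pi>R[OF ps] in \<open>auto simp: listset_replicate\<close>)
    finally show ?thesis
      using R.subspace_diff[OF R.subspace_carrier R.closed[OF ps]
          R.subspace_scale[OF R.subspace_carrier R.closed[OF perm]]]
      by (simp add: angle_bracket_def)
  qed
  then have "?CR \<subseteq> ?D"
    unfolding relative_commutator_def[of "prod_scale sB"]
    by (intro hull_minimal D) (auto simp: listset_replicate)
  then show ?thesis by auto
qed

end

theory Submission
  imports Defs
begin

text \<open>
  Write \<open>K\<close> for the kernel of \<open>f\<close>. Both conditions are equivalent to a third one, \<open>skew_on K\<close>: the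
  bracket of \<open>B\<close> is skew-symmetric on all lists with at least one entry in \<open>K\<close>.

  The commutator of \<open>K, B, \<dots>, B\<close> is generated by the failures of skew-symmetry with the entry from
  \<open>K\<close> in the first place, and a permutation moves it to any other place; so this commutator is zero
  iff \<open>skew_on K\<close> holds (\<open>relative_commutator_eq_zero_iff\<close>).

  If the extension is central, the two components of \<open>angle_bracket\<close> agree on lists from \<open>R[f]\<close>. With
  \<open>(k, 0)\<close> in one place and \<open>(b, b)\<close> in the others, the second component is zero, hence so is the
  first (\<open>skew_on_if_central\<close>).

  Conversely, assume \<open>skew_on K\<close>. The commutator of \<open>R[f]\<close> has to be contained in the diagonal of
  \<open>B \<times> B\<close>, and for this it is enough to find an ideal of \<open>R[f]\<close> that contains its generators and
  consists of diagonal elements. The two components of a generator agree by multilinearity, because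
  entries of \<open>R[f]\<close> differ by elements of \<open>K\<close>. But bracketing a diagonal element \<open>(z, z)\<close> with
  elements of \<open>R[f]\<close> stays in the diagonal only if every bracket that contains both \<open>z\<close> and an element
  of \<open>K\<close> vanishes. Let \<open>Z\<close>, the \<open>annihilator\<close> of \<open>K\<close>, be the set of these \<open>z\<close>. By \<open>skew_on K\<close>,
  membership in \<open>Z\<close> can be tested on brackets that begin with \<open>z\<close> and an element of \<open>K\<close>, and there the
  Leibniz identity applies. It shows that \<open>Z\<close> is an ideal (\<open>n_ideal_annihilator\<close>), and, since right
  multiplications are derivations also of \<open>angle_bracket\<close> (\<open>br_angle_bracket\<close>), that \<open>Z\<close> contains
  all values of \<open>angle_bracket\<close> (\<open>angle_bracket_in_annihilator\<close>). So the diagonal of \<open>Z\<close> is the ideal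
  sought (\<open>central_if_skew_on\<close>).
\<close>

section \<open>Lists and permutations\<close>

(* as simplification rules, these two loop together with nlists_def *)
declare nlistsE_length [simp del] nlistsE_set [simp del]

lemma nlists_permute_list:
  "xs \<in> nlists n A \<Longrightarrow> \<sigma> permutes {..<n} \<Longrightarrow> permute_list \<sigma> xs \<in> nlists n A"
  by (auto simp: nlists_def)

lemma permute_list_update:
  assumes "\<sigma> permutes {..<length xs}" and "i < length xs"
  shows "permute_list \<sigma> (xs[\<sigma> i := x]) = (permute_list \<sigma> xs)[i := x]"
proof (rule nth_equalityI)
  fix j assume "j < length (permute_list \<sigma> (xs[\<sigma> i := x]))"
  then have j: "j < length xs" by simp
  have "\<sigma> i < length xs" and "\<sigma> j < length xs"
    using permutes_in_image[OF assms(1)] assms(2) j by auto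
  moreover have "\<sigma> i = \<sigma> j \<longleftrightarrow> i = j"
    using permutes_inj[OF assms(1)] by (auto dest: injD)
  ultimately show "permute_list \<sigma> (xs[\<sigma> i := x]) ! j = (permute_list \<sigma> xs)[i := x] ! j"
    using assms j by (simp add: permute_list_nth nth_list_update)
qed simp

text \<open>
  Telescoping: \<open>xs\<close> becomes \<open>ys\<close> by changing one entry at a time, from left to right. The
  intermediate lists mix entries of \<open>xs\<close> and \<open>ys\<close>, so \<open>step\<close> need only cover such lists; in
  particular they keep every entry that \<open>xs\<close> and \<open>ys\<close> share.
\<close>

lemma eq_if_eq_entrywise_change:
  assumes len: "length xs = n" "length ys = n"
    and step: "\<And>zs m. \<lbrakk>m < n; length zs = n; \<And>i. i < n \<Longrightarrow> zs ! i = xs ! i \<or> zs ! i = ys ! i\<rbrakk>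
      \<Longrightarrow> \<phi> (zs[m := xs ! m]) = \<phi> (zs[m := ys ! m])"
  shows "\<phi> xs = \<phi> ys"
proof -
  let ?h = "\<lambda>m. take m ys @ drop m xs"
  have "\<phi> (?h m) = \<phi> xs" if "m \<le> n" for m
    using that
  proof (induction m)
    case (Suc m)
    have nth: "?h m ! i = (if i < m then ys ! i else xs ! i)" if "i < n" for i
      using that Suc.prems len by (auto simp: nth_append)
    have "(?h m)[m := xs ! m] = ?h m" and "(?h m)[m := ys ! m] = ?h (Suc m)"
      using Suc.prems len by (auto intro!: nth_equalityI simp: nth_append nth_list_update less_Suc_eq)
    moreover have "\<phi> ((?h m)[m := xs ! m]) = \<phi> ((?h m)[m := ys ! m])"
      by (rule step) (use Suc.prems len nth in auto)
    ultimately show ?case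
      using Suc by simp
  qed simp
  from this[of n] show ?thesis using len by simp
qed

section \<open>Brackets that are skew as soon as one entry lies in an ideal\<close>

context leibniz_n_algebra
begin

lemma br_update_diff:
  assumes "xs \<in> nlists n L" "i < n" "x \<in> L" "y \<in> L"
  shows "br (xs[i := x - y]) = br (xs[i := x]) - br (xs[i := y])"
  using add[OF assms(1,2) subspace_diff[OF subspace_carrier assms(3,4)] assms(4)] by simp

lemma br_update_zero:
  assumes "xs \<in> nlists n L" "i < n"
  shows "br (xs[i := 0]) = 0"
  using scale[OF assms subspace_0[OF subspace_carrier], of 0] by simp

lemma br_zero_entry:
  assumes "xs \<in> nlists n L" "i < n" "xs ! i = 0"
  shows "br xs = 0"
  using br_update_zero[OF assms(1,2)] assms(3) list_update_id[of xs i] by simp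

lemma angle_bracket_update_diff:
  assumes xs: "xs \<in> nlists n L" and i: "i < n" and x: "x \<in> L" "y \<in> L"
    and \<sigma>: "\<sigma> permutes {..<n}"
  shows "angle_bracket scale br \<sigma> (xs[i := x - y]) =
    angle_bracket scale br \<sigma> (xs[i := x]) - angle_bracket scale br \<sigma> (xs[i := y])"
proof -
  obtain j where j: "j < n" "\<sigma> j = i"
    using permutes_image[OF \<sigma>] i by (metis imageE lessThan_iff)
  have perm: "permute_list \<sigma> (xs[i := z]) = (permute_list \<sigma> xs)[j := z]" for z
    using permute_list_update[of \<sigma> xs j z] \<sigma> j nlistsE_length[OF xs] by simp
  show ?thesis
    unfolding angle_bracket_def perm
      br_update_diff[OF xs i x] br_update_diff[OF nlists_permute_list[OF xs \<sigma>] j(1) x]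
    by (simp add: scale_right_diff_distrib)
qed

lemma angle_bracket_closed:
  assumes "xs \<in> nlists n L" "\<sigma> permutes {..<n}"
  shows "angle_bracket scale br \<sigma> xs \<in> L"
  unfolding angle_bracket_def
  by (intro subspace_diff subspace_scale subspace_carrier closed nlists_permute_list assms)

text \<open>
  The Leibniz identity says that \<open>\<lambda>x. br (x # ys)\<close> is a derivation of the bracket. Since permuting
  the arguments only permutes the summands, it is also a derivation of every
  \<open>angle_bracket scale br \<sigma>\<close>.
\<close>

lemma br_angle_bracket:
  assumes xs: "xs \<in> nlists n L" and ys: "ys \<in> nlists (n - 1) L"
    and \<sigma>: "\<sigma> permutes {..<n}" and n: "n \<ge> 1"
  shows "br (angle_bracket scale br \<sigma> xs # ys) =
    (\<Sum>i<n. angle_bracket scale br \<sigma> (xs[i := br (xs ! i # ys)]))"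
proof -
  let ?c = "of_int (sign \<sigma>) :: 'k" and ?p = "permute_list \<sigma> xs"
  have p: "?p \<in> nlists n L" by (rule nlists_permute_list[OF xs \<sigma>])
  have len: "length xs = n" using nlistsE_length[OF xs] .
  have Cons: "0 # ys \<in> nlists n L"
    using ys n subspace_0[OF subspace_carrier] by (auto simp: nlists_def)
  have "br (angle_bracket scale br \<sigma> xs # ys) = br (br xs # ys) - br (scale ?c (br ?p) # ys)"
    using br_update_diff[OF Cons, of 0 "br xs" "scale ?c (br ?p)"] n
      closed[OF xs] subspace_scale[OF subspace_carrier closed[OF p]]
    by (simp add: angle_bracket_def)
  also have "br (scale ?c (br ?p) # ys) = scale ?c (br (br ?p # ys))"
    using scale[OF Cons, of 0 "br ?p" ?c] n closed[OF p] by simp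
  also have "br (br ?p # ys) = (\<Sum>i<n. br (?p[i := br (?p ! i # ys)]))"
    by (rule leibniz[OF p ys])
  also have "\<dots> = (\<Sum>i<n. br (permute_list \<sigma> (xs[\<sigma> i := br (xs ! \<sigma> i # ys)])))"
    using \<sigma> len by (intro sum.cong refl) (simp add: permute_list_update permute_list_nth)
  also have "\<dots> = (\<Sum>i<n. br (permute_list \<sigma> (xs[i := br (xs ! i # ys)])))"
    by (rule sum.reindex_bij_betw[OF permutes_imp_bij[OF \<sigma>],
          where g = "\<lambda>i. br (permute_list \<sigma> (xs[i := br (xs ! i # ys)]))"])
  finally show ?thesis
    by (simp add: leibniz[OF xs ys] angle_bracket_def sum_subtractf scale_sum_right)
qed

definition skew_on :: "'v set \<Rightarrow> bool" where
  "skew_on K \<longleftrightarrow> (\<forall>xs\<in>nlists n L. \<forall>\<sigma>. \<sigma> permutes {..<n} \<longrightarrow> (\<exists>i<n. xs ! i \<in> K) \<longrightarrow>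
    angle_bracket scale br \<sigma> xs = 0)"

lemma n_ideal_zero: "n_ideal scale n L br {0}"
  using subspace_0[OF subspace_carrier] br_zero_entry by (auto simp: n_ideal_def subspace_def)

text \<open>
  The generators of the relative commutator have their entry from \<open>K\<close> in the first position only;
  since all permutations are allowed, any other position can be moved to the first one.
\<close>

lemma relative_commutator_eq_zero_iff:
  assumes n: "n \<ge> 1" and K: "K \<subseteq> L"
  shows "relative_commutator scale n L br (K # replicate (n - 1) L) = {0} \<longleftrightarrow> skew_on K"
    (is "?C = _ \<longleftrightarrow> _")
proof -
  let ?X = "{angle_bracket scale br \<sigma> xs | \<sigma> xs.
    \<sigma> permutes {..<n} \<and> xs \<in> listset (K # replicate (n - 1) L)}"
  have mem: "xs \<in> listset (K # replicate (n - 1) L) \<longleftrightarrow> xs \<in> nlists n L \<and> xs ! 0 \<in> K" for xs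
    using n K by (cases xs; cases n) (auto simp: set_Cons_def listset_replicate nlists_Suc simp del: replicate.simps)
  show ?thesis
  proof
    assume C: "?C = {0}"
    show "skew_on K"
      unfolding skew_on_def
    proof (intro ballI allI impI)
      fix xs \<sigma> assume xs: "xs \<in> nlists n L" and \<sigma>: "\<sigma> permutes {..<n}" and "\<exists>i<n. xs ! i \<in> K"
      then obtain i where i: "i < n" "xs ! i \<in> K" by blast
      let ?\<tau> = "transpose 0 i"
      let ?ys = "permute_list ?\<tau> xs"
      have len: "length xs = n" using nlistsE_length[OF xs] .
      have \<tau>: "?\<tau> permutes {..<n}"
        using i by (intro permutes_swap_id) auto
      have "?ys ! 0 \<in> K"
        using i \<tau> len by (simp add: permute_list_nth)
      then have ys: "?ys \<in> listset (K # replicate (n - 1) L)"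
        unfolding mem using nlists_permute_list[OF xs \<tau>] by simp
      have gen: "br ?ys = scale (of_int (sign \<rho>)) (br (permute_list \<rho> ?ys))"
        if "\<rho> permutes {..<n}" for \<rho>
      proof -
        have "angle_bracket scale br \<rho> ?ys \<in> ?C"
          unfolding relative_commutator_def by (rule hull_inc) (use that ys in blast)
        then show ?thesis using C by (simp add: angle_bracket_def)
      qed
      have undo: "permute_list ?\<tau> ?ys = xs"
        using permute_list_compose[of ?\<tau> xs ?\<tau>] \<tau> len by simp
      have shift: "permute_list (?\<tau> \<circ> \<sigma>) ?ys = permute_list \<sigma> xs"
        using permute_list_compose[of \<sigma> ?ys ?\<tau>] \<sigma> len undo by simp
      have "permutation ?\<tau>" "permutation \<sigma>"
        using \<tau> \<sigma> permutes_imp_permutation finite_lessThan by blast+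
      then have "scale (of_int (sign ?\<tau>)) (br xs) =
          scale (of_int (sign ?\<tau>)) (scale (of_int (sign \<sigma>)) (br (permute_list \<sigma> xs)))"
        using gen[OF \<tau>] gen[OF permutes_compose[OF \<sigma> \<tau>]]
        by (simp only: undo shift sign_compose of_int_mult scale_scale)
      then show "angle_bracket scale br \<sigma> xs = 0"
        by (auto simp: angle_bracket_def sign_def split: if_splits)
    qed
  next
    assume skew: "skew_on K"
    then have "?X \<subseteq> {0}"
      unfolding skew_on_def mem using n by fastforce
    then have "?C \<subseteq> {0}"
      unfolding relative_commutator_def by (rule hull_minimal) (rule n_ideal_zero)
    moreover have "0 \<in> ?C"
      unfolding relative_commutator_def hull_def by (auto simp: n_ideal_def subspace_0)
    ultimately show "?C = {0}" by blast
  qed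
qed

section \<open>The elements annihilated by an ideal\<close>

definition annihilator :: "'v set \<Rightarrow> 'v set" where
  "annihilator K = {z \<in> L. \<forall>xs\<in>nlists n L. \<forall>i<n. \<forall>j<n.
    i \<noteq> j \<longrightarrow> xs ! i = z \<longrightarrow> xs ! j \<in> K \<longrightarrow> br xs = 0}"

text \<open>
  With an entry in \<open>K\<close> the order of the arguments matters only up to sign, so that it is enough to
  test with \<open>z\<close> in the first position, where the Leibniz identity applies.
\<close>

lemma annihilatorI:
  assumes skew: "skew_on K" and z: "z \<in> L"
    and zero: "\<And>k cs. k \<in> K \<Longrightarrow> k # cs \<in> nlists (n - 1) L \<Longrightarrow> br (z # k # cs) = 0"
  shows "z \<in> annihilator K"
  unfolding annihilator_def
proof (intro CollectI conjI ballI allI impI z)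
  fix xs i j
  assume xs: "xs \<in> nlists n L" and ij: "i < n" "j < n" "i \<noteq> j"
    and xsi: "xs ! i = z" and xsj: "xs ! j \<in> K"
  let ?j = "transpose 0 i j"
  \<comment> \<open>a permutation with \<open>0 \<mapsto> i\<close> and \<open>1 \<mapsto> j\<close>\<close>
  let ?\<sigma> = "transpose 0 i \<circ> transpose 1 ?j"
  have len: "length xs = n" using nlistsE_length[OF xs] .
  have j: "?j < n" "?j \<noteq> 0"
    using ij by (auto simp: transpose_def)
  have \<sigma>: "?\<sigma> permutes {..<n}"
    using ij j by (intro permutes_compose permutes_swap_id) auto
  have \<sigma>01: "?\<sigma> 0 = i" "?\<sigma> 1 = j"
    using j by simp_all
  let ?ys = "permute_list ?\<sigma> xs"
  have ys: "?ys \<in> nlists n L" by (rule nlists_permute_list[OF xs \<sigma>])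
  have "?ys ! 0 = z" "?ys ! 1 \<in> K"
    using permute_list_nth[of ?\<sigma> xs 0] permute_list_nth[of ?\<sigma> xs 1] \<sigma> len ij xsi xsj
    unfolding \<sigma>01 by auto
  moreover obtain a k cs where "?ys = a # k # cs"
    using nlistsE_length[OF ys] ij by (cases ?ys; cases "tl ?ys") auto
  ultimately have "br ?ys = 0"
    using zero[of k cs] ys by (auto simp: nlists_def)
  moreover have "angle_bracket scale br ?\<sigma> xs = 0"
    using skew xs \<sigma> ij xsj unfolding skew_on_def by blast
  ultimately show "br xs = 0"
    by (simp add: angle_bracket_def)
qed

lemma br_annihilator:
  assumes "z \<in> annihilator K" "xs \<in> nlists n L" "i < n" "j < n" "i \<noteq> j" "xs ! i = z" "xs ! j \<in> K"
  shows "br xs = 0"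
  using assms by (simp add: annihilator_def)

lemma annihilator_subset: "annihilator K \<subseteq> L"
  by (auto simp: annihilator_def)

lemma subspace_annihilator:
  assumes skew: "skew_on K" and n: "n \<ge> 2"
  shows "subspace (annihilator K)"
proof -
  have Cons: "z # k # cs \<in> nlists n L"
    if "k # cs \<in> nlists (n - 1) L" "z \<in> L" for z k cs
    using that n by (auto simp: nlists_def)
  have ann: "br (z # k # cs) = 0"
    if "z \<in> annihilator K" "k \<in> K" "k # cs \<in> nlists (n - 1) L" for z k cs
    using br_annihilator[OF that(1) Cons[OF that(3) subsetD[OF annihilator_subset that(1)]], of 0 1]
      that n by simp
  show ?thesis
    unfolding subspace_def
  proof (intro conjI ballI allI)
    show "0 \<in> annihilator K"
      using br_zero_entry subspace_0[OF subspace_carrier] by (auto simp: annihilator_def)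
  next
    fix x y assume x: "x \<in> annihilator K" and y: "y \<in> annihilator K"
    then have L: "x \<in> L" "y \<in> L" using annihilator_subset by auto
    show "x + y \<in> annihilator K"
    proof (rule annihilatorI[OF skew subspace_add[OF subspace_carrier L]])
      fix k cs assume k: "k \<in> K" "k # cs \<in> nlists (n - 1) L"
      show "br ((x + y) # k # cs) = 0"
        using add[OF Cons[OF k(2) L(1)], of 0 x y] L n ann[OF x k] ann[OF y k] by simp
    qed
  next
    fix c x assume x: "x \<in> annihilator K"
    then have L: "x \<in> L" using annihilator_subset by auto
    show "scale c x \<in> annihilator K"
    proof (rule annihilatorI[OF skew subspace_scale[OF subspace_carrier L]])
      fix k cs assume k: "k \<in> K" "k # cs \<in> nlists (n - 1) L"
      show "br (scale c x # k # cs) = 0"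
        using scale[OF Cons[OF k(2) L], of 0 x c] L n ann[OF x k] by simp
    qed
  qed
qed

lemma br_ideal_second:
  assumes K: "n_ideal scale n L br K" and n: "n \<ge> 2"
    and "x \<in> L" "k \<in> K" "k # cs \<in> nlists (n - 1) L"
  shows "br (x # k # cs) \<in> K"
proof -
  have "x # k # cs \<in> nlists n L" using assms by (auto simp: nlists_def)
  moreover have "1 < n" "(x # k # cs) ! 1 \<in> K" using assms by auto
  ultimately show ?thesis using K unfolding n_ideal_def by blast
qed

text \<open>
  For \<open>z\<close> annihilated by \<open>K\<close>, expand \<open>br (br xs # k # cs)\<close> with \<open>z\<close> an entry of \<open>xs\<close> by the Leibniz
  identity: \<open>k\<close> either acts on \<open>z\<close>, giving \<open>0\<close>, or on another entry, which then becomes an element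
  of \<open>K\<close> next to \<open>z\<close>.
\<close>

lemma n_ideal_annihilator:
  assumes skew: "skew_on K" and K: "n_ideal scale n L br K" and n: "n \<ge> 2"
  shows "n_ideal scale n L br (annihilator K)"
  unfolding n_ideal_def
proof (intro conjI ballI impI subspace_annihilator[OF skew n] annihilator_subset)
  fix xs assume xs: "xs \<in> nlists n L" and "\<exists>i<n. xs ! i \<in> annihilator K"
  then obtain i where i: "i < n" "xs ! i \<in> annihilator K" by blast
  have len: "length xs = n" using nlistsE_length[OF xs] .
  show "br xs \<in> annihilator K"
  proof (rule annihilatorI[OF skew closed[OF xs]])
    fix k cs assume k: "k \<in> K" "k # cs \<in> nlists (n - 1) L"
    have "br (xs[j := br (xs ! j # k # cs)]) = 0" if j: "j < n" for j
    proof (cases "j = i")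
      case True
      have "xs ! i # k # cs \<in> nlists n L"
        using k n nlistsE_nth_in[OF xs i(1)] by (auto simp: nlists_def)
      then have "br (xs ! i # k # cs) = 0"
        using br_annihilator[OF i(2), of _ 0 1] n k by simp
      then show ?thesis using br_update_zero[OF xs i(1)] True by simp
    next
      case False
      let ?w = "br (xs ! j # k # cs)"
      have w: "?w \<in> K" by (rule br_ideal_second[OF K n nlistsE_nth_in[OF xs j] k])
      then have "?w \<in> L" using K by (auto simp: n_ideal_def)
      then show ?thesis
        using br_annihilator[OF i(2) nlists_update_in_list[OF xs], of ?w i j j] i j False w len by simp
    qed
    then show "br (br xs # k # cs) = 0"
      by (simp add: leibniz[OF xs k(2)])
  qed
qed

lemma angle_bracket_in_annihilator:
  assumes skew: "skew_on K" and K: "n_ideal scale n L br K" and n: "n \<ge> 2"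
    and xs: "xs \<in> nlists n L" and \<sigma>: "\<sigma> permutes {..<n}"
  shows "angle_bracket scale br \<sigma> xs \<in> annihilator K"
proof (rule annihilatorI[OF skew angle_bracket_closed[OF xs \<sigma>]])
  fix k cs assume k: "k \<in> K" "k # cs \<in> nlists (n - 1) L"
  have "angle_bracket scale br \<sigma> (xs[i := br (xs ! i # k # cs)]) = 0" if i: "i < n" for i
  proof -
    let ?w = "br (xs ! i # k # cs)"
    have w: "?w \<in> K" by (rule br_ideal_second[OF K n nlistsE_nth_in[OF xs i] k])
    then have "?w \<in> L" using K by (auto simp: n_ideal_def)
    then have "xs[i := ?w] \<in> nlists n L" by (rule nlists_update_in_list[OF xs])
    moreover have "xs[i := ?w] ! i \<in> K" using w i nlistsE_length[OF xs] by simp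
    ultimately show ?thesis using skew \<sigma> i unfolding skew_on_def by blast
  qed
  then show "br (angle_bracket scale br \<sigma> xs # k # cs) = 0"
    using br_angle_bracket[OF xs k(2) \<sigma>] n by simp
qed

text \<open>
  Changing one entry modulo \<open>K\<close> changes a multilinear function by its value on a list with an entry
  in \<open>K\<close>. For \<open>angle_bracket\<close> this value is zero by \<open>skew_on K\<close>; for the bracket it is zero as
  long as another entry lies in the annihilator of \<open>K\<close>.
\<close>

lemma angle_bracket_cong_mod:
  assumes skew: "skew_on K" and K: "K \<subseteq> L"
    and xs: "xs \<in> nlists n L" and ys: "ys \<in> nlists n L" and \<sigma>: "\<sigma> permutes {..<n}"
    and diff: "\<And>i. i < n \<Longrightarrow> xs ! i - ys ! i \<in> K"
  shows "angle_bracket scale br \<sigma> xs = angle_bracket scale br \<sigma> ys"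
proof (rule eq_if_eq_entrywise_change[OF nlistsE_length[OF xs] nlistsE_length[OF ys]])
  fix zs m assume m: "m < n" and len: "length zs = n"
    and "\<And>i. i < n \<Longrightarrow> zs ! i = xs ! i \<or> zs ! i = ys ! i"
  then have zs: "zs \<in> nlists n L"
    using nlistsE_nth_in[OF xs] nlistsE_nth_in[OF ys]
    by (intro nlistsI) (auto simp: in_set_conv_nth, metis)
  let ?us = "zs[m := xs ! m - ys ! m]"
  have "?us \<in> nlists n L" "?us ! m \<in> K"
    using nlists_update_in_list[OF zs subsetD[OF K diff[OF m]]] diff[OF m] m len by auto
  then have "angle_bracket scale br \<sigma> ?us = 0"
    using skew \<sigma> m unfolding skew_on_def by blast
  then show "angle_bracket scale br \<sigma> (zs[m := xs ! m]) = angle_bracket scale br \<sigma> (zs[m := ys ! m])"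
    using angle_bracket_update_diff[OF zs m nlistsE_nth_in[OF xs m] nlistsE_nth_in[OF ys m] \<sigma>] by simp
qed

lemma br_cong_mod:
  assumes K: "K \<subseteq> L"
    and xs: "xs \<in> nlists n L" and ys: "ys \<in> nlists n L"
    and diff: "\<And>i. i < n \<Longrightarrow> xs ! i - ys ! i \<in> K"
    and i: "i < n" "xs ! i \<in> annihilator K" "ys ! i = xs ! i"
  shows "br xs = br ys"
proof (rule eq_if_eq_entrywise_change[OF nlistsE_length[OF xs] nlistsE_length[OF ys]])
  fix zs m assume m: "m < n" and len: "length zs = n"
    and sel: "\<And>i. i < n \<Longrightarrow> zs ! i = xs ! i \<or> zs ! i = ys ! i"
  then have zs: "zs \<in> nlists n L"
    using nlistsE_nth_in[OF xs] nlistsE_nth_in[OF ys]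
    by (intro nlistsI) (auto simp: in_set_conv_nth, metis)
  show "br (zs[m := xs ! m]) = br (zs[m := ys ! m])"
  proof (cases "m = i")
    case False
    let ?us = "zs[m := xs ! m - ys ! m]"
    have "zs ! i = xs ! i" using sel[OF i(1)] i(3) by auto
    then have "br ?us = 0"
      using br_annihilator[OF i(2) nlists_update_in_list[OF zs], of "xs ! m - ys ! m" i m m]
        i m False diff[OF m] K len by auto
    then show ?thesis
      using br_update_diff[OF zs m nlistsE_nth_in[OF xs m] nlistsE_nth_in[OF ys m]] by simp
  qed (simp add: i)
qed

end

section \<open>Central extensions\<close>

lemma n_algebra_hom_zero:
  assumes "leibniz_n_algebra sB n B brB" "n_algebra_hom sB sA n B brB A brA f"
  shows "f 0 = 0"
proof -
  interpret leibniz_n_algebra sB n B brB by fact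
  have "f (0 + 0) = f 0 + f 0"
    using assms(2) subspace_0[OF subspace_carrier] by (simp only: n_algebra_hom_def)
  then show ?thesis by simp
qed

lemma n_ideal_hom_kernel:
  assumes "leibniz_n_algebra sB n B brB" "leibniz_n_algebra sA n A brA"
    and hom: "n_algebra_hom sB sA n B brB A brA f"
  shows "n_ideal sB n B brB (hom_kernel B f)"
proof -
  interpret B: leibniz_n_algebra sB n B brB by fact
  interpret A: leibniz_n_algebra sA n A brA by fact
  have f0: "f 0 = 0" using n_algebra_hom_zero[OF assms(1) hom] .
  have "brB xs \<in> hom_kernel B f"
    if xs: "xs \<in> nlists n B" and i: "i < n" "xs ! i \<in> hom_kernel B f" for xs i
  proof -
    have "map f xs \<in> nlists n A"
      using xs hom by (fastforce simp: nlists_def n_algebra_hom_def)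
    then have "brA (map f xs) = 0"
      using A.br_zero_entry[of "map f xs" i] i nlistsE_length[OF xs] by (simp add: hom_kernel_def)
    then show ?thesis
      using hom xs B.closed[OF xs] by (simp add: hom_kernel_def n_algebra_hom_def)
  qed
  moreover have "B.subspace (hom_kernel B f)"
    using B.subspace_carrier hom f0
    by (auto simp: B.subspace_def hom_kernel_def n_algebra_hom_def)
  ultimately show ?thesis
    by (auto simp: n_ideal_def hom_kernel_def)
qed

lemma diff_in_hom_kernel:
  assumes "leibniz_n_algebra sB n B brB" and hom: "n_algebra_hom sB sA n B brB A brA f"
    and xy: "x \<in> B" "y \<in> B" "f x = f y"
  shows "x - y \<in> hom_kernel B f"
proof -
  interpret leibniz_n_algebra sB n B brB by fact
  have d: "x - y \<in> B" using subspace_diff[OF subspace_carrier] xy by blast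
  then have "f (x - y + y) = f (x - y) + f y"
    using hom xy by (simp only: n_algebra_hom_def)
  then show ?thesis using d xy by (simp add: hom_kernel_def)
qed

lemma angle_bracket_prod:
  assumes "\<sigma> permutes {..<length ps}"
  shows "angle_bracket (prod_scale s) (prod_bracket br) \<sigma> ps =
    (angle_bracket s br \<sigma> (map fst ps), angle_bracket s br \<sigma> (map snd ps))"
  using assms by (simp add: angle_bracket_def prod_scale_def prod_bracket_def permute_list_map)

lemma nlists_kernel_pairD:
  assumes "ps \<in> nlists n (kernel_pair B f)"
  shows "map fst ps \<in> nlists n B" "map snd ps \<in> nlists n B"
    and "\<And>i. i < n \<Longrightarrow> f (map fst ps ! i) = f (map snd ps ! i)"
proof -
  have *: "fst p \<in> B \<and> snd p \<in> B \<and> f (fst p) = f (snd p)" if "p \<in> set ps" for p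
    using subsetD[OF nlistsE_set[OF assms] that] by (auto simp: kernel_pair_def)
  show "map fst ps \<in> nlists n B" "map snd ps \<in> nlists n B"
    using * nlistsE_length[OF assms] by (auto intro!: nlistsI)
  show "\<And>i. i < n \<Longrightarrow> f (map fst ps ! i) = f (map snd ps ! i)"
    using * nlistsE_length[OF assms] by simp
qed

text \<open>
  For a list with \<open>k \<in> K\<close> in position \<open>i\<close>, take \<open>(k, 0)\<close> in that position and pairs \<open>(b, b)\<close> in the
  others: the second component of \<open>angle_bracket\<close> then has a zero entry.
\<close>

lemma skew_on_if_central:
  assumes B: "leibniz_n_algebra sB n B brB" and hom: "n_algebra_hom sB sA n B brB A brA f"
    and central: "central_extension sB n B brB f"
  shows "leibniz_n_algebra.skew_on sB n B brB (hom_kernel B f)"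
proof -
  interpret B: leibniz_n_algebra sB n B brB by fact
  let ?R = "kernel_pair B f"
  show ?thesis
    unfolding B.skew_on_def
  proof (intro ballI allI impI)
    fix xs \<sigma>
    assume xs: "xs \<in> nlists n B" and \<sigma>: "\<sigma> permutes {..<n}" and "\<exists>i<n. xs ! i \<in> hom_kernel B f"
    then obtain i where i: "i < n" "xs ! i \<in> hom_kernel B f" by blast
    let ?ys = "xs[i := 0]"
    let ?ps = "zip xs ?ys"
    have len: "length xs = n" using nlistsE_length[OF xs] .
    have zero: "0 \<in> B" by (rule B.subspace_0[OF B.subspace_carrier])
    have ys: "?ys \<in> nlists n B" by (rule nlists_update_in_list[OF xs zero])
    have f0: "f 0 = 0" by (rule n_algebra_hom_zero[OF B hom])
    have "?ps \<in> nlists n ?R"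
    proof (rule nlistsI)
      show "set ?ps \<subseteq> ?R"
        using nlistsE_nth_in[OF xs] i len zero f0
        by (auto simp: set_zip kernel_pair_def hom_kernel_def nth_list_update)
    qed (simp add: len)
    then have "angle_bracket (prod_scale sB) (prod_bracket brB) \<sigma> ?ps
        \<in> relative_commutator (prod_scale sB) n ?R (prod_bracket brB) (replicate n ?R)"
      unfolding relative_commutator_def
      by (intro hull_inc) (use \<sigma> in \<open>auto simp: listset_replicate\<close>)
    then have "fst (angle_bracket (prod_scale sB) (prod_bracket brB) \<sigma> ?ps) =
        snd (angle_bracket (prod_scale sB) (prod_bracket brB) \<sigma> ?ps)"
      using central by (simp add: central_extension_def Let_def)
    then have "angle_bracket sB brB \<sigma> xs = angle_bracket sB brB \<sigma> ?ys"
      using \<sigma> len by (simp add: angle_bracket_prod)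
    also have "\<dots> = 0"
      using B.angle_bracket_update_diff[OF xs i(1) zero zero \<sigma>] by simp
    finally show "angle_bracket sB brB \<sigma> xs = 0" .
  qed
qed

text \<open>
  The diagonal of \<open>B\<close> need not be an ideal of the kernel pair, but the diagonal of the annihilator of
  the kernel is one, and it still contains all generators of the commutator.
\<close>

lemma central_if_skew_on:
  assumes B: "leibniz_n_algebra sB n B brB" and A: "leibniz_n_algebra sA n A brA"
    and hom: "n_algebra_hom sB sA n B brB A brA f" and n: "n \<ge> 2"
    and skew: "leibniz_n_algebra.skew_on sB n B brB (hom_kernel B f)"
  shows "central_extension sB n B brB f"
proof -
  interpret B: leibniz_n_algebra sB n B brB by fact
  interpret P: vector_space "prod_scale sB"
    by (rule vector_space_prod_scale) (rule B.vector_space_axioms)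
  let ?R = "kernel_pair B f" and ?K = "hom_kernel B f"
  let ?Z = "B.annihilator ?K"
  let ?D = "(\<lambda>z. (z, z)) ` ?Z"
  have K: "n_ideal sB n B brB ?K" by (rule n_ideal_hom_kernel[OF B A hom])
  have KB: "?K \<subseteq> B" by (auto simp: hom_kernel_def)
  have Z: "n_ideal sB n B brB ?Z" by (rule B.n_ideal_annihilator[OF skew K n])
  have diff: "map fst ps ! i - map snd ps ! i \<in> ?K"
    if ps: "ps \<in> nlists n ?R" and i: "i < n" for ps i
    using diff_in_hom_kernel[OF B hom nlistsE_nth_in[OF nlists_kernel_pairD(1)[OF ps] i]
        nlistsE_nth_in[OF nlists_kernel_pairD(2)[OF ps] i] nlists_kernel_pairD(3)[OF ps i]] .
  have "P.subspace ?D"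
    using B.subspace_annihilator[OF skew n]
    by (auto simp: P.subspace_def B.subspace_def prod_scale_def zero_prod_def)
  moreover have "?D \<subseteq> ?R"
    using B.annihilator_subset by (auto simp: kernel_pair_def)
  moreover have "prod_bracket brB ps \<in> ?D" if ps: "ps \<in> nlists n ?R" and i: "i < n" "ps ! i \<in> ?D" for ps i
  proof -
    note m = nlists_kernel_pairD[OF ps]
    have Zi: "map fst ps ! i \<in> ?Z" "map snd ps ! i = map fst ps ! i"
      using i nlistsE_length[OF ps] by auto
    have "brB (map fst ps) = brB (map snd ps)"
      using B.br_cong_mod[OF KB m(1,2) diff[OF ps] i(1) Zi] .
    moreover have "brB (map fst ps) \<in> ?Z"
      using Z m(1) i(1) Zi(1) unfolding n_ideal_def by blast
    ultimately show ?thesis by (auto simp: prod_bracket_def)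
  qed
  ultimately have D: "n_ideal (prod_scale sB) n ?R (prod_bracket brB) ?D"
    unfolding n_ideal_def by blast
  have "angle_bracket (prod_scale sB) (prod_bracket brB) \<sigma> ps \<in> ?D"
    if \<sigma>: "\<sigma> permutes {..<n}" and ps: "ps \<in> nlists n ?R" for \<sigma> ps
  proof -
    note m = nlists_kernel_pairD[OF ps]
    have "angle_bracket sB brB \<sigma> (map fst ps) = angle_bracket sB brB \<sigma> (map snd ps)"
      by (rule B.angle_bracket_cong_mod[OF skew KB m(1,2) \<sigma> diff[OF ps]])
    then show ?thesis
      using B.angle_bracket_in_annihilator[OF skew K n m(1) \<sigma>] \<sigma> nlistsE_length[OF ps]
      by (auto simp: angle_bracket_prod)
  qed
  then have "relative_commutator (prod_scale sB) n ?R (prod_bracket brB) (replicate n ?R) \<subseteq> ?D"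
    unfolding relative_commutator_def
    by (intro hull_minimal D) (auto simp: listset_replicate)
  then show ?thesis
    by (auto simp: central_extension_def Let_def)
qed

theorem proposition5p4:
  fixes sB :: "'k::field \<Rightarrow> 'b::ab_group_add \<Rightarrow> 'b"
    and sA :: "'k \<Rightarrow> 'a::ab_group_add \<Rightarrow> 'a"
    and n :: nat
    and B :: "'b set" and brB :: "'b list \<Rightarrow> 'b"
    and A :: "'a set" and brA :: "'a list \<Rightarrow> 'a"
    and f :: "'b \<Rightarrow> 'a"
  assumes "n \<ge> 2"
    and "CHAR('k) \<noteq> 2"
    and "leibniz_n_algebra sB n B brB"
    and "leibniz_n_algebra sA n A brA"
    and "extension sB sA n B brB A brA f"
  shows "central_extension sB n B brB f \<longleftrightarrow>
    relative_commutator sB n B brB (hom_kernel B f # replicate (n - 1) B) = {0}"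
proof -
  interpret B: leibniz_n_algebra sB n B brB by fact
  have hom: "n_algebra_hom sB sA n B brB A brA f"
    using assms(5) by (simp add: extension_def)
  have "central_extension sB n B brB f \<longleftrightarrow> B.skew_on (hom_kernel B f)"
    using skew_on_if_central[OF assms(3) hom] central_if_skew_on[OF assms(3,4) hom assms(1)] by blast
  also have "\<dots> \<longleftrightarrow> relative_commutator sB n B brB (hom_kernel B f # replicate (n - 1) B) = {0}"
    using assms(1) by (intro B.relative_commutator_eq_zero_iff[symmetric]) (auto simp: hom_kernel_def)
  finally show ?thesis .
qed

end
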